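(* Let $n\ge 1$. The group $\mathcal{L}_-^\tau(\mathrm{GL}(n,\mathbb{C}),\mathbb{C}^n)$ of negative rational loops satisfying the $\mathrm{GL}(n,\mathbb{R})$-reality condition $\overline{g(\bar\lambda)}=g(\lambda)$ is generated (as a group under pointwise multiplication) by the following elements, where in (1)–(3) $\alpha,\beta\in\mathbb{C}$ are distinct: (1) $p_{\alpha,\beta,V,W}(\lambda)=\left(\frac{\lambda-\alpha}{\lambda-\beta}\right)\pi_V+\pi_W$, where $\alpha,\beta\in\mathbb{R}$, $\mathbb{C}^n=V\oplus W$, $\overline{V}=V$, $\overline{W}=W$; (2) $q_{\alpha,\beta,V,W}(\lambda)=\frac{(\lambda-\alpha)(\lambda-\bar\alpha)}{(\lambda-\beta)(\lambda-\bar\beta)}\pi_V+\pi_W$, where $\alpha\notin\mathbb{R}$ or $\beta\notin\mathbb{R}$, $\mathbb{C}^n=V\oplus W$, $\overline{V}=V$, $\overline{W}=W$; (3) $r_{\alpha,\beta,V,W}(\lambda)=\left(\frac{\lambda-\alpha}{\lambda-\beta}\right)\pi_V+\pi_W+\left(\frac{\lambda-\bar\alpha}{\lambda-\bar\beta}\right)\pi_{\overline{V}}$, where $\mathbb{C}^n=V\oplus W\oplus\overline{V}$ (so $V\cap\overline{V}=0$) and $\overline{W}=W$; (4) $m_{\alpha,k,N}(\lambda)=\mathrm{Id}+\left(\frac{1}{\lambda-\alpha}\right)^kN$, where $\alpha\in\mathbb{R}$, $k$ is a positive integer, and $N:\mathbb{C}^n\to\mathbb{C}^n$ is linear with $N^2=0$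 and $\overline{N}=N$.
   Context: A rational loop in $\mathrm{GL}(n,\mathbb{C})$ is a meromorphic map $g:\mathbb{CP}^1\to \mathrm{GL}(n,\mathbb{C})$, i.e. an $n\times n$ matrix of rational functions of $\lambda$ taking values in $\mathrm{GL}(n,\mathbb{C})$ away from finitely many points. It is negative if $g(\infty)=\mathrm{Id}$. Let $\tau(A)=\overline{A}$ be entrywise complex conjugation on $\mathrm{GL}(n,\mathbb{C})$; $g$ satisfies the reality condition with respect to $\tau$ if $\tau(g(\lambda))=g(\bar\lambda)$ for all $\lambda$. $\mathcal{L}_-^\tau(\mathrm{GL}(n,\mathbb{C}),\mathbb{C}^n)$ is the group of negative rational loops satisfying this reality condition. $V,W$ are complex subspaces of $\mathbb{C}^n$, bars on subspaces and matrices denote complex conjugation, and the maps $\pi_V,\pi_W,\pi_{\overline V}$ are the projections onto the subspace in the subscript along the given direct sum decomposition. *)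

theory Defs
  imports
    "HOL-Analysis.Analysis"
    "HOL-Algebra.Generated_Groups"
    "HOL-Computational_Algebra.Computational_Algebra"
    "HOL-Computational_Algebra.Field_as_Ring"
begin

text \<open>
  A rational function of \<open>\<lambda>\<close> is an element of the fraction field of the polynomial ring over the
  complex numbers, and pointwise multiplication of matrix-valued rational functions (away from
  poles) is matrix multiplication over that field.
\<close>

type_synonym ratfun = "complex poly fract"
type_synonym 'n loop = "ratfun^'n^'n"

text \<open>
  Evaluation uses the representation in lowest terms, so that removable singularities are
  removed; at a pole the value is \<open>0\<close> by the convention \<open>x / 0 = 0\<close> and carries no meaning.
\<close>

definition rf_pole :: "ratfun \<Rightarrow> complex \<Rightarrow> bool" where
  "rf_pole f z \<longleftrightarrow> poly (snd (quot_of_fract f)) z = 0"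

definition rf_eval :: "ratfun \<Rightarrow> complex \<Rightarrow> complex" where
  "rf_eval f z = poly (fst (quot_of_fract f)) z / poly (snd (quot_of_fract f)) z"

definition loop_pole :: "'n::finite loop \<Rightarrow> complex \<Rightarrow> bool" where
  "loop_pole g z \<longleftrightarrow> (\<exists>i j. rf_pole (g $ i $ j) z)"

definition loop_eval :: "'n::finite loop \<Rightarrow> complex \<Rightarrow> complex^'n^'n" where
  "loop_eval g z = map_matrix (\<lambda>f. rf_eval f z) g"

definition rational_loop :: "'n::finite loop \<Rightarrow> bool" where
  "rational_loop g \<longleftrightarrow> finite {z. loop_pole g z \<or> \<not> invertible (loop_eval g z)}"

definition negative_loop :: "'n::finite loop \<Rightarrow> bool" where
  "negative_loop g \<longleftrightarrow> (loop_eval g \<longlongrightarrow> mat 1) at_infinity"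

definition cnj_vec :: "complex^'n \<Rightarrow> complex^'n" where
  "cnj_vec v = (\<chi> i. cnj (v $ i))"

definition reality_condition :: "'n::finite loop \<Rightarrow> bool" where
  "reality_condition g \<longleftrightarrow>
     (\<forall>z. \<not> loop_pole g z \<and> \<not> loop_pole g (cnj z) \<longrightarrow> map_matrix cnj (loop_eval g (cnj z)) = loop_eval g z)"

definition real_negative_loops :: "('n::finite loop) monoid" where
  "real_negative_loops =
     \<lparr>carrier = {g. rational_loop g \<and> negative_loop g \<and> reality_condition g},
      mult = (**), one = mat 1\<rparr>"

text \<open>
  \<open>direct_decomp Us\<close>: the whole space is the internal direct sum of the complex subspaces listed
  in \<open>Us\<close> (\<open>vec.subspace\<close> is closed under multiplication by complex scalars).
  \<open>proj_mat Us k\<close> is the matrix of the projection onto the subspace \<open>Us ! k\<close> along the sum of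
  the others; it is meaningful only for a direct decomposition.  Subspaces are addressed by
  position because the same subspace may occur twice (e.g. the zero subspace).
\<close>

definition decomposes :: "(complex^'n::finite) set list \<Rightarrow> complex^'n \<Rightarrow> (complex^'n) list \<Rightarrow> bool" where
  "decomposes Us x us \<longleftrightarrow> list_all2 (\<in>) us Us \<and> sum_list us = x"

definition direct_decomp :: "(complex^'n::finite) set list \<Rightarrow> bool" where
  "direct_decomp Us \<longleftrightarrow> (\<forall>U \<in> set Us. vec.subspace U) \<and> (\<forall>x. \<exists>!us. decomposes Us x us)"

definition proj_mat :: "(complex^'n::finite) set list \<Rightarrow> nat \<Rightarrow> complex^'n^'n" where
  "proj_mat Us k = matrix (\<lambda>x. (THE us. decomposes Us x us) ! k)"

definition rf_const :: "complex \<Rightarrow> ratfun" where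
  "rf_const c = to_fract [:c:]"

text \<open>The coordinate function \<open>\<lambda>\<close>.\<close>

definition rf_var :: ratfun where
  "rf_var = to_fract [:0, 1:]"

definition scaled_loop :: "ratfun \<Rightarrow> complex^'n^'n \<Rightarrow> 'n::finite loop" where
  "scaled_loop f A = map_matrix (\<lambda>c. f * rf_const c) A"

definition const_loop :: "complex^'n^'n \<Rightarrow> 'n::finite loop" where
  "const_loop A = map_matrix rf_const A"

definition p_loop :: "complex \<Rightarrow> complex \<Rightarrow> (complex^'n) set \<Rightarrow> (complex^'n) set \<Rightarrow> 'n::finite loop" where
  "p_loop \<alpha> \<beta> V W =
     scaled_loop ((rf_var - rf_const \<alpha>) / (rf_var - rf_const \<beta>)) (proj_mat [V, W] 0)
     + const_loop (proj_mat [V, W] 1)"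

definition q_loop :: "complex \<Rightarrow> complex \<Rightarrow> (complex^'n) set \<Rightarrow> (complex^'n) set \<Rightarrow> 'n::finite loop" where
  "q_loop \<alpha> \<beta> V W =
     scaled_loop (((rf_var - rf_const \<alpha>) * (rf_var - rf_const (cnj \<alpha>)))
                  / ((rf_var - rf_const \<beta>) * (rf_var - rf_const (cnj \<beta>)))) (proj_mat [V, W] 0)
     + const_loop (proj_mat [V, W] 1)"

definition r_loop :: "complex \<Rightarrow> complex \<Rightarrow> (complex^'n) set \<Rightarrow> (complex^'n) set \<Rightarrow> 'n::finite loop" where
  "r_loop \<alpha> \<beta> V W =
     (let Us = [V, W, cnj_vec ` V] in
     scaled_loop ((rf_var - rf_const \<alpha>) / (rf_var - rf_const \<beta>)) (proj_mat Us 0)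
     + const_loop (proj_mat Us 1)
     + scaled_loop ((rf_var - rf_const (cnj \<alpha>)) / (rf_var - rf_const (cnj \<beta>))) (proj_mat Us 2))"

definition m_loop :: "complex \<Rightarrow> nat \<Rightarrow> complex^'n^'n \<Rightarrow> 'n::finite loop" where
  "m_loop \<alpha> k N = mat 1 + scaled_loop ((1 / (rf_var - rf_const \<alpha>)) ^ k) N"

definition p_loops :: "('n::finite loop) set" where
  "p_loops = {p_loop \<alpha> \<beta> V W | \<alpha> \<beta> V W.
     \<alpha> \<noteq> \<beta> \<and> \<alpha> \<in> \<real> \<and> \<beta> \<in> \<real> \<and> direct_decomp [V, W] \<and> cnj_vec ` V = V \<and> cnj_vec ` W = W}"

definition q_loops :: "('n::finite loop) set" where
  "q_loops = {q_loop \<alpha> \<beta> V W | \<alpha> \<beta> V W.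
     \<alpha> \<noteq> \<beta> \<and> (\<alpha> \<notin> \<real> \<or> \<beta> \<notin> \<real>) \<and> direct_decomp [V, W] \<and> cnj_vec ` V = V \<and> cnj_vec ` W = W}"

definition r_loops :: "('n::finite loop) set" where
  "r_loops = {r_loop \<alpha> \<beta> V W | \<alpha> \<beta> V W.
     \<alpha> \<noteq> \<beta> \<and> direct_decomp [V, W, cnj_vec ` V] \<and> cnj_vec ` W = W}"

definition m_loops :: "('n::finite loop) set" where
  "m_loops = {m_loop \<alpha> k N | \<alpha> k N.
     \<alpha> \<in> \<real> \<and> 0 < k \<and> N ** N = 0 \<and> map_matrix cnj N = N}"

end

theory Submission
  imports Defs
begin

text \<open>
  The entries of \<open>g - 1\<close> are rational functions with real coefficients that vanish at infinity.  Such
  functions form the maximal ideal of a local ring (the real rational functions regular at infinity,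
  with uniformizer \<open>1 / \<lambda>\<close>), so the loops are exactly the matrices over that ring that are congruent
  to the identity modulo the maximal ideal.  Gaussian elimination then works without pivoting and
  writes \<open>g\<close> as a product of dilations (a unit \<open>u\<close> with \<open>u(\<infinity>) = 1\<close> in one diagonal position) and
  transvections (an element \<open>c\<close> of the maximal ideal in one off-diagonal position).  Factoring
  numerator and denominator of \<open>u\<close> over the reals, a dilation is a product of elements \<open>p\<^bsub>a,0\<^esub>\<close>
  and \<open>q\<^bsub>a,0\<^esub>\<close> and their inverses.  Since \<open>c = l u / \<lambda>\<^sup>m\<close> with \<open>l\<close> real and \<open>u\<close> a unit as above,
  a transvection is a conjugate of an \<open>m\<close>-type element with pole at \<open>0\<close> by a dilation.  In particular the
  elements of type \<open>r\<close>, and those of type \<open>m\<close> with other poles, are redundant.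
\<close>

subsection \<open>Real polynomials\<close>

text \<open>Real coefficients are encoded as invariance under conjugation, so closure and
  cancellation reduce to \<open>map_poly cnj\<close> being an injective ring homomorphism.\<close>

definition real_poly :: "complex poly \<Rightarrow> bool" where
  "real_poly p \<longleftrightarrow> map_poly cnj p = p"

lemma map_poly_cnj_add: "map_poly cnj (p + q) = map_poly cnj p + map_poly cnj q"
  by (rule poly_eqI) (simp add: coeff_map_poly)

lemma map_poly_cnj_diff: "map_poly cnj (p - q) = map_poly cnj p - map_poly cnj q"
  by (rule poly_eqI) (simp add: coeff_map_poly)

lemma map_poly_cnj_mult: "map_poly cnj (p * q) = map_poly cnj p * map_poly cnj q"
  by (subst poly_eq_poly_eq_iff [symmetric]) (simp add: fun_eq_iff)

lemma map_poly_cnj_map_poly_cnj: "map_poly cnj (map_poly cnj p) = p"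
  by (rule poly_eqI) (simp add: coeff_map_poly)

lemma degree_map_poly_cnj [simp]: "degree (map_poly cnj p) = degree p"
  by (rule degree_map_poly) auto

lemma map_poly_cnj_eq_0_iff [simp]: "map_poly cnj p = 0 \<longleftrightarrow> p = 0"
  by (metis map_poly_0 map_poly_cnj_map_poly_cnj)

lemma real_poly_add: "real_poly p \<Longrightarrow> real_poly q \<Longrightarrow> real_poly (p + q)"
  by (simp add: real_poly_def map_poly_cnj_add)

lemma real_poly_diff: "real_poly p \<Longrightarrow> real_poly q \<Longrightarrow> real_poly (p - q)"
  by (simp add: real_poly_def map_poly_cnj_diff)

lemma real_poly_mult: "real_poly p \<Longrightarrow> real_poly q \<Longrightarrow> real_poly (p * q)"
  by (simp add: real_poly_def map_poly_cnj_mult)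

lemma real_poly_0 [simp]: "real_poly 0"
  and real_poly_1 [simp]: "real_poly 1"
  by (simp_all add: real_poly_def map_poly_1)

lemma real_poly_pCons [simp]: "real_poly (pCons a p) \<longleftrightarrow> a \<in> \<real> \<and> real_poly p"
  by (auto simp: real_poly_def map_poly_pCons Reals_cnj_iff)

lemma real_poly_power: "real_poly p \<Longrightarrow> real_poly (p ^ n)"
  by (induction n) (auto intro: real_poly_mult)

lemma real_poly_smult: "a \<in> \<real> \<Longrightarrow> real_poly p \<Longrightarrow> real_poly (smult a p)"
  using real_poly_mult[of "[:a:]" p] by simp

lemma real_poly_lead_coeff: "real_poly p \<Longrightarrow> lead_coeff p \<in> \<real>"
  unfolding real_poly_def Reals_cnj_iff
  by (metis coeff_map_poly complex_cnj_zero)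

text \<open>Conjugating the product and cancelling the real factor \<open>p\<close> shows that
  \<open>q\<close> is its own conjugate. This keeps the cofactor real when a real factor is split
  off.\<close>

lemma real_poly_cancel:
  assumes "real_poly (p * q)" "real_poly p" "p \<noteq> 0"
  shows "real_poly q"
  using assms by (simp add: real_poly_def map_poly_cnj_mult)

lemma real_poly_conj_mult: "real_poly (p * map_poly cnj p)"
  by (simp add: real_poly_def map_poly_cnj_mult map_poly_cnj_map_poly_cnj mult.commute)

lemma real_poly_conj_add: "real_poly (p + map_poly cnj p)"
  by (simp add: real_poly_def map_poly_cnj_add map_poly_cnj_map_poly_cnj add.commute)

lemma to_fract_nonzero: "p \<noteq> 0 \<Longrightarrow> to_fract p \<noteq> (0 :: ratfun)"
  by simp

subsection \<open>Strictly proper real rational functions\<close>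

text \<open>The fraction need not be in lowest terms, so sums and products can use the plain common
  denominator. The strict degree inequality already excludes \<open>q = 0\<close>.\<close>

definition strictly_proper_real :: "ratfun set" where
  "strictly_proper_real =
     {to_fract p / to_fract q | p q. real_poly p \<and> real_poly q \<and> degree p < degree q}"

lemma strictly_proper_realI:
  "f = to_fract p / to_fract q \<Longrightarrow> real_poly p \<Longrightarrow> real_poly q \<Longrightarrow> degree p < degree q
    \<Longrightarrow> f \<in> strictly_proper_real"
  by (auto simp: strictly_proper_real_def)

lemma strictly_proper_realE:
  assumes "f \<in> strictly_proper_real"
  obtains p q where "f = to_fract p / to_fract q" "real_poly p" "real_poly q"
    "degree p < degree q" "q \<noteq> 0"
  using assms unfolding strictly_proper_real_def by force

lemma strictly_proper_real_0 [simp]: "0 \<in> strictly_proper_real"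
  by (rule strictly_proper_realI[of _ 0 "[:0, 1:]"]) auto

lemma degree_add_mult_less:
  fixes p q r s :: "complex poly"
  assumes "degree p < degree q" "degree r < degree s"
  shows "degree (p * s + r * q) < degree (q * s)"
proof -
  have nz: "q \<noteq> 0" "s \<noteq> 0" using assms by auto
  have "degree (p * s) < degree q + degree s" "degree (r * q) < degree q + degree s"
    using degree_mult_le[of p s] degree_mult_le[of r q] assms by linarith+
  then show ?thesis
    using degree_add_less nz by (simp add: degree_mult_eq)
qed

lemma strictly_proper_real_add:
  assumes "f \<in> strictly_proper_real" "g \<in> strictly_proper_real"
  shows "f + g \<in> strictly_proper_real"
proof -
  from assms(1) obtain p q where 1: "f = to_fract p / to_fract q" "real_poly p" "real_poly q"
    "degree p < degree q" "q \<noteq> 0" by (rule strictly_proper_realE)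
  from assms(2) obtain r s where 2: "g = to_fract r / to_fract s" "real_poly r" "real_poly s"
    "degree r < degree s" "s \<noteq> 0" by (rule strictly_proper_realE)
  have "f + g = to_fract (p * s + r * q) / to_fract (q * s)"
    unfolding 1(1) 2(1) using 1(5) 2(5) by (simp add: add_frac_eq)
  then show ?thesis
    by (rule strictly_proper_realI)
       (use 1 2 in \<open>auto intro!: real_poly_add real_poly_mult degree_add_mult_less\<close>)
qed

text \<open>The ideal property: any real factor regular at infinity is absorbed. Products inside the
  ideal and real scalar multiples are special cases.\<close>

lemma strictly_proper_real_mult_proper:
  assumes "f \<in> strictly_proper_real" "real_poly r" "real_poly s" "degree r \<le> degree s" "s \<noteq> 0"
  shows "f * (to_fract r / to_fract s) \<in> strictly_proper_real"
proof -
  from assms(1) obtain p q where 1: "f = to_fract p / to_fract q" "real_poly p" "real_poly q"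
    "degree p < degree q" "q \<noteq> 0" by (rule strictly_proper_realE)
  have "degree (p * r) < degree (q * s)"
    using degree_mult_le[of p r] 1 assms by (simp add: degree_mult_eq)
  then show ?thesis
    by (intro strictly_proper_realI[of _ "p * r" "q * s"]) (use 1 assms in \<open>auto intro!: real_poly_mult\<close>)
qed

lemma strictly_proper_real_mult:
  assumes "f \<in> strictly_proper_real" "g \<in> strictly_proper_real"
  shows "f * g \<in> strictly_proper_real"
proof -
  from assms(2) obtain p q where 1: "g = to_fract p / to_fract q" "real_poly p" "real_poly q"
    "degree p < degree q" "q \<noteq> 0" by (rule strictly_proper_realE)
  show ?thesis
    unfolding 1(1) using 1 assms(1) by (intro strictly_proper_real_mult_proper) auto
qed

lemma strictly_proper_real_scale:
  assumes "f \<in> strictly_proper_real" "c \<in> \<real>"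
  shows "f * rf_const c \<in> strictly_proper_real"
  using strictly_proper_real_mult_proper[of f "[:c:]" 1] assms
  by (simp add: rf_const_def)

lemma strictly_proper_real_uminus:
  assumes "f \<in> strictly_proper_real"
  shows "- f \<in> strictly_proper_real"
proof -
  from assms obtain p q where 1: "f = to_fract p / to_fract q" "real_poly p" "real_poly q"
    "degree p < degree q" "q \<noteq> 0" by (rule strictly_proper_realE)
  show ?thesis
    by (rule strictly_proper_realI[of _ "- p" q]) (use 1 real_poly_diff[of 0 p] in auto)
qed

lemma strictly_proper_real_sum:
  "(\<And>i. i \<in> A \<Longrightarrow> f i \<in> strictly_proper_real) \<Longrightarrow> sum f A \<in> strictly_proper_real"
  by (induction A rule: infinite_finite_induct) (auto intro: strictly_proper_real_add)

text \<open>If \<open>u - 1\<close> is \<open>p / q\<close>, then \<open>u\<close> is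
  \<open>(p + q) / q\<close>, and the smaller degree of \<open>p\<close> leaves the leading term of
  \<open>q\<close> untouched. Dividing both by the real leading coefficient makes them
  monic.\<close>

lemma one_plus_strictly_properE:
  assumes "u - 1 \<in> strictly_proper_real"
  obtains p q where "u = to_fract p / to_fract q" "real_poly p" "real_poly q"
    "lead_coeff p = 1" "lead_coeff q = 1" "degree p = degree q"
proof -
  from assms obtain p q where 1: "u - 1 = to_fract p / to_fract q" "real_poly p" "real_poly q"
    "degree p < degree q" "q \<noteq> 0" by (rule strictly_proper_realE)
  let ?c = "inverse (lead_coeff q)"
  have c: "?c \<in> \<real>" "?c \<noteq> 0"
    using real_poly_lead_coeff[OF 1(3)] 1(5) by auto
  have deg: "degree (p + q) = degree q" and lc: "lead_coeff (p + q) = lead_coeff q"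
    using 1(4) by (auto simp: degree_add_eq_right coeff_eq_0)
  have "u = to_fract (smult ?c (p + q)) / to_fract (smult ?c q)"
  proof -
    have smult: "to_fract (smult ?c r) = to_fract [:?c:] * to_fract r" for r
      by (simp flip: to_fract_mult)
    have "to_fract [:?c:] \<noteq> 0" using c by simp
    then have "to_fract (smult ?c (p + q)) / to_fract (smult ?c q) = to_fract (p + q) / to_fract q"
      unfolding smult by (rule mult_divide_mult_cancel_left)
    also have "\<dots> = (u - 1) + 1" unfolding 1(1) using 1(5) by (simp add: add_divide_distrib)
    also have "\<dots> = u" by simp
    finally show ?thesis ..
  qed
  moreover have "lead_coeff (smult ?c (p + q)) = 1"
    unfolding lead_coeff_smult lc using 1(5) by simp
  moreover have "lead_coeff (smult ?c q) = 1"
    unfolding lead_coeff_smult using 1(5) by simp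
  moreover have "degree (smult ?c (p + q)) = degree (smult ?c q)"
    using c(2) deg by simp
  ultimately show ?thesis
    using that real_poly_smult[OF c(1) 1(3)] real_poly_smult[OF c(1) real_poly_add[OF 1(2,3)]]
    by metis
qed

lemma degree_diff_monic_less:
  fixes p q :: "complex poly"
  assumes "degree p = degree q" "lead_coeff p = lead_coeff q" "p \<noteq> q"
  shows "degree (p - q) < degree q"
proof -
  have "degree (p - q) \<le> degree q" using assms by (intro degree_diff_le) auto
  moreover have "coeff (p - q) (degree q) = 0" using assms by auto
  ultimately show ?thesis
    using assms(3) leading_coeff_0_iff[of "p - q"] by (cases "degree (p - q) = degree q") auto
qed

lemma one_plus_strictly_properI:
  assumes "real_poly p" "real_poly q" "lead_coeff p = lead_coeff q" "degree p = degree q" "q \<noteq> 0"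
  shows "to_fract p / to_fract q - 1 \<in> strictly_proper_real"
\<comment> \<open>Equal polynomials are set apart: if they are constant, the degree inequality would
  read 0 < 0.\<close>
proof (cases "p = q")
  case True
  then show ?thesis using assms by simp
next
  case False
  have "to_fract p / to_fract q - 1 = to_fract (p - q) / to_fract q"
    using assms(5) by (simp add: diff_divide_distrib)
  then show ?thesis
    by (rule strictly_proper_realI)
       (use assms False in \<open>auto intro!: real_poly_diff degree_diff_monic_less\<close>)
qed

lemma one_plus_strictly_proper_nonzero:
  assumes "u - 1 \<in> strictly_proper_real"
  shows "u \<noteq> 0"
proof
  assume "u = 0"
  from assms obtain p q where "u = to_fract p / to_fract q" "real_poly p" "real_poly q"
    "lead_coeff p = 1" "lead_coeff q = 1" "degree p = degree q" by (rule one_plus_strictly_properE)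
  with \<open>u = 0\<close> have "p = 0 \<or> q = 0" by simp
  with \<open>lead_coeff p = 1\<close> \<open>lead_coeff q = 1\<close> show False by auto
qed

lemma one_plus_strictly_proper_inverse:
  assumes "u - 1 \<in> strictly_proper_real"
  shows "1 / u - 1 \<in> strictly_proper_real"
proof -
  from assms obtain p q where "u = to_fract p / to_fract q" "real_poly p" "real_poly q"
    "lead_coeff p = 1" "lead_coeff q = 1" "degree p = degree q" by (rule one_plus_strictly_properE)
  then have "to_fract q / to_fract p - 1 \<in> strictly_proper_real"
    by (intro one_plus_strictly_properI) auto
  with \<open>u = _\<close> show ?thesis by simp
qed

subsection \<open>Evaluation and behaviour at infinity\<close>

lemma rf_lowest_terms:
  obtains a b where "f = to_fract a / to_fract b" "b \<noteq> 0" "coprime a b"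
    "\<And>z. rf_pole f z \<longleftrightarrow> poly b z = 0" "\<And>z. rf_eval f z = poly a z / poly b z"
proof
  show "f = to_fract (fst (quot_of_fract f)) / to_fract (snd (quot_of_fract f))"
    by (simp flip: Fract_conv_to_fract)
qed (auto simp: rf_pole_def rf_eval_def coprime_quot_of_fract)

text \<open>By coprimality the reduced denominator divides \<open>q\<close>, so \<open>q\<close> not
  vanishing at \<open>z\<close> rules out a pole there. Hence any such fraction, reduced or not, may
  be used for evaluation.\<close>

lemma
  assumes "f = to_fract p / to_fract q" "poly q z \<noteq> 0"
  shows rf_eval_quotient: "rf_eval f z = poly p z / poly q z"
    and not_rf_pole_quotient: "\<not> rf_pole f z"
proof -
  obtain a b where ab: "f = to_fract a / to_fract b" "b \<noteq> 0" "coprime a b"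
    "\<And>z. rf_pole f z \<longleftrightarrow> poly b z = 0" "\<And>z. rf_eval f z = poly a z / poly b z"
    by (rule rf_lowest_terms [of f]) blast
  have "q \<noteq> 0" using assms(2) by auto
  then have "to_fract (a * q) = to_fract (p * b)"
    using ab(1,2) assms(1) by (simp add: frac_eq_eq)
  then have eq: "a * q = p * b" unfolding to_fract_eq_iff .
  then have "b dvd q"
    using ab(3) by (metis coprime_commute coprime_dvd_mult_right_iff dvd_triv_right)
  then have "poly b z \<noteq> 0" using assms(2) by (auto simp: dvd_def)
  moreover from eq have "poly a z * poly q z = poly p z * poly b z"
    by (metis poly_mult)
  ultimately show "rf_eval f z = poly p z / poly q z" "\<not> rf_pole f z"
    using assms(2) by (auto simp: ab(4,5) frac_eq_eq)
qed

text \<open>The common denominator \<open>b * d\<close> may fail to be reduced, but it does not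
  vanish at \<open>z\<close>, which is all that evaluation of a quotient asks for.\<close>

lemma
  assumes "\<not> rf_pole f z" "\<not> rf_pole g z"
  shows rf_eval_add: "rf_eval (f + g) z = rf_eval f z + rf_eval g z"
    and not_rf_pole_add: "\<not> rf_pole (f + g) z"
    and rf_eval_mult: "rf_eval (f * g) z = rf_eval f z * rf_eval g z"
    and not_rf_pole_mult: "\<not> rf_pole (f * g) z"
proof -
  obtain a b where 1: "f = to_fract a / to_fract b" "b \<noteq> 0"
    "\<And>z. rf_pole f z \<longleftrightarrow> poly b z = 0" "\<And>z. rf_eval f z = poly a z / poly b z"
    by (rule rf_lowest_terms [of f]) blast
  obtain c d where 2: "g = to_fract c / to_fract d" "d \<noteq> 0"
    "\<And>z. rf_pole g z \<longleftrightarrow> poly d z = 0" "\<And>z. rf_eval g z = poly c z / poly d z"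
    by (rule rf_lowest_terms [of g]) blast
  have s: "f + g = to_fract (a * d + c * b) / to_fract (b * d)"
    unfolding 1(1) 2(1) using 1(2) 2(2) by (simp add: add_frac_eq)
  have m: "f * g = to_fract (a * c) / to_fract (b * d)"
    unfolding 1(1) 2(1) by simp
  have nz: "poly b z \<noteq> 0" "poly d z \<noteq> 0" using assms 1 2 by auto
  show "rf_eval (f + g) z = rf_eval f z + rf_eval g z" 
    by (subst rf_eval_quotient[OF s]) (use nz in \<open>auto simp: 1(4) 2(4) add_frac_eq\<close>)
  show "\<not> rf_pole (f + g) z"
    by (rule not_rf_pole_quotient[OF s]) (use nz in auto)
  show "rf_eval (f * g) z = rf_eval f z * rf_eval g z" 
    by (subst rf_eval_quotient[OF m]) (use nz in \<open>auto simp: 1(4) 2(4) add_frac_eq\<close>)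
  show "\<not> rf_pole (f * g) z"
    by (rule not_rf_pole_quotient[OF m]) (use nz in auto)
qed

lemma rf_eval_0 [simp]: "rf_eval 0 z = 0"
  and rf_eval_1 [simp]: "rf_eval 1 z = 1"
  and not_rf_pole_0 [simp]: "\<not> rf_pole 0 z"
  and not_rf_pole_1 [simp]: "\<not> rf_pole 1 z"
  by (auto simp: rf_eval_def rf_pole_def)

lemma rf_eval_sum:
  assumes "\<And>i. i \<in> A \<Longrightarrow> \<not> rf_pole (f i) z"
  shows "rf_eval (sum f A) z = (\<Sum>i\<in>A. rf_eval (f i) z) \<and> \<not> rf_pole (sum f A) z"
  using assms
  by (induction A rule: infinite_finite_induct) (auto simp: rf_eval_add not_rf_pole_add)

lemma finite_rf_poles: "finite {z. rf_pole f z}"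
  unfolding rf_pole_def by (rule poly_roots_finite) simp

lemma finite_loop_poles: "finite {z. loop_pole g z}"
proof -
  have "{z. loop_pole g z} = (\<Union>i. \<Union>j. {z. rf_pole (g $ i $ j) z})"
    by (auto simp: loop_pole_def)
  then show ?thesis by (simp add: finite_rf_poles)
qed

lemma loop_eval_mult:
  assumes "\<not> loop_pole g z" "\<not> loop_pole h z"
  shows "loop_eval (g ** h) z = loop_eval g z ** loop_eval h z"
  using assms
  by (auto simp: loop_eval_def map_matrix_def matrix_matrix_mult_def vec_eq_iff loop_pole_def
      rf_eval_sum rf_eval_mult not_rf_pole_mult)

lemma loop_eval_mat_1: "loop_eval (mat 1) z = mat 1"
  by (auto simp: loop_eval_def map_matrix_def mat_def vec_eq_iff)

section \<open>Degrees and limits at infinity\<close>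

lemma tendsto_quotient_at_infinity:
  fixes p q :: "complex poly"
  assumes "q \<noteq> 0"
  shows "((\<lambda>z. (poly p z / z ^ degree p) / (poly q z / z ^ degree q)) \<longlongrightarrow>
    lead_coeff p / lead_coeff q) at_infinity"
  using assms by (intro tendsto_divide poly_divide_tendsto_aux) auto

lemma eventually_nonzero_at_infinity: "\<forall>\<^sub>F z::complex in at_infinity. z \<noteq> 0"
  by (rule eventually_at_infinityI[of 1]) auto

lemma tendsto_inverse_power_at_infinity:
  "((\<lambda>z::complex. inverse z ^ k) \<longlongrightarrow> 0 ^ k) at_infinity"
  by (intro tendsto_power tendsto_inverse_0)

text \<open>The quotient is a convergent normalised quotient times a positive power of
  \<open>1 / z\<close>.\<close>

lemma degree_less_imp_tendsto_0:
  fixes p q :: "complex poly"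
  assumes "degree p < degree q"
  shows "((\<lambda>z. poly p z / poly q z) \<longlongrightarrow> 0) at_infinity"
proof -
  define k where "k = degree q - degree p"
  have q: "q \<noteq> 0" using assms by auto
  have "((\<lambda>z. (poly p z / z ^ degree p) / (poly q z / z ^ degree q) * inverse z ^ k) \<longlongrightarrow>
      lead_coeff p / lead_coeff q * 0 ^ k) at_infinity"
    by (intro tendsto_mult tendsto_quotient_at_infinity tendsto_inverse_power_at_infinity q)
  moreover have "\<forall>\<^sub>F z in at_infinity. (poly p z / z ^ degree p) / (poly q z / z ^ degree q) * inverse z ^ k
      = poly p z / poly q z"
    using eventually_nonzero_at_infinity
  proof eventually_elim
    case (elim z)
    have "degree q = degree p + k" using assms by (simp add: k_def)
    then show ?case using elim by (simp add: power_add power_inverse divide_simps)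
  qed
  ultimately show ?thesis
    using assms by (auto simp: k_def power_0_left elim: Lim_transform_eventually)
qed

lemma tendsto_0_imp_degree_less:
  fixes p q :: "complex poly"
  assumes "((\<lambda>z. poly p z / poly q z) \<longlongrightarrow> 0) at_infinity" "p \<noteq> 0" "q \<noteq> 0"
  shows "degree p < degree q"
proof (rule ccontr)
  assume "\<not> degree p < degree q"
  then obtain k where k: "degree p = degree q + k"
    by (metis le_iff_add not_less)
  \<comment> \<open>Here \<open>k = 0\<close> is possible, where \<open>0 ^ k\<close> is 1; the
    limit is 0 in any case because of the first factor. The normalised quotient would then have
    limit 0 although its leading coefficients are nonzero.\<close>
  have "((\<lambda>z. (poly p z / poly q z) * inverse z ^ k) \<longlongrightarrow> 0 * 0 ^ k) at_infinity"
    by (intro tendsto_mult tendsto_inverse_power_at_infinity assms)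
  moreover have "\<forall>\<^sub>F z in at_infinity. (poly p z / poly q z) * inverse z ^ k
      = (poly p z / z ^ degree p) / (poly q z / z ^ degree q)"
    using eventually_nonzero_at_infinity
    by eventually_elim (simp add: k power_add power_inverse divide_simps)
  ultimately have "((\<lambda>z. (poly p z / z ^ degree p) / (poly q z / z ^ degree q)) \<longlongrightarrow> 0) at_infinity"
    by (auto elim: Lim_transform_eventually)
  with tendsto_quotient_at_infinity[OF assms(3), of p]
  have "lead_coeff p / lead_coeff q = 0"
    by (rule tendsto_unique[OF trivial_limit_at_infinity])
  then show False using assms by simp
qed

lemma rf_const_0 [simp]: "rf_const 0 = 0"
  and rf_const_1 [simp]: "rf_const 1 = 1"
  by (simp_all add: rf_const_def flip: one_pCons)

lemma rf_const_add: "rf_const (a + b) = rf_const a + rf_const b"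
  by (simp add: rf_const_def flip: to_fract_add)

lemma rf_eval_const [simp]: "rf_eval (rf_const d) z = d"
  and not_rf_pole_const [simp]: "\<not> rf_pole (rf_const d) z"
  by (simp_all add: rf_const_def rf_eval_def rf_pole_def)

text \<open>The reduced fraction \<open>a / b\<close> is compared with a real fraction
  \<open>r / q\<close>. Eliminating \<open>r\<close> from \<open>a * q = r * b\<close> and its
  conjugate, then cancelling \<open>q\<close> as a polynomial, gives a symmetry of \<open>a\<close>
  and \<open>b\<close> that holds also at roots of \<open>q\<close> that are not poles of
  \<open>f\<close>.\<close>

lemma strictly_proper_real_eval_cnj:
  assumes "f - rf_const d \<in> strictly_proper_real" "d \<in> \<real>"
    and "\<not> rf_pole f z" "\<not> rf_pole f (cnj z)"
  shows "cnj (rf_eval f (cnj z)) = rf_eval f z"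
proof -
  from assms(1) obtain p q where 1: "f - rf_const d = to_fract p / to_fract q"
    "real_poly p" "real_poly q" "degree p < degree q" "q \<noteq> 0"
    by (rule strictly_proper_realE)
  define r where "r = p + [:d:] * q"
  have r: "real_poly r"
    unfolding r_def using 1 assms(2) by (intro real_poly_add real_poly_mult) auto
  obtain a b where ab: "f = to_fract a / to_fract b" "b \<noteq> 0"
    "\<And>z. rf_pole f z \<longleftrightarrow> poly b z = 0" "\<And>z. rf_eval f z = poly a z / poly b z"
    by (rule rf_lowest_terms [of f]) blast
  have "f = (f - rf_const d) + rf_const d" by simp
  also have "\<dots> = to_fract p / to_fract q + rf_const d"
    by (simp only: 1(1))
  also have "\<dots> = to_fract r / to_fract q"
    unfolding r_def to_fract_add to_fract_mult rf_const_def
    using 1(5) by (simp add: add_divide_distrib)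
  finally have "to_fract (a * q) = to_fract (r * b)"
    unfolding ab(1) using 1(5) ab(2) by (simp add: frac_eq_eq)
  then have eq: "a * q = r * b" unfolding to_fract_eq_iff .
  then have "map_poly cnj a * q = r * map_poly cnj b"
    using r 1 by (metis map_poly_cnj_mult real_poly_def)
  with eq have "map_poly cnj a * b * q = a * map_poly cnj b * q"
    by (metis (no_types, opaque_lifting) mult.assoc mult.commute)
  then have "map_poly cnj a * b = a * map_poly cnj b" using 1 by simp
  then have "poly (map_poly cnj a * b) z = poly (a * map_poly cnj b) z" by simp
  then have "cnj (poly a (cnj z)) * poly b z = poly a z * cnj (poly b (cnj z))"
    by simp
  moreover have "poly b z \<noteq> 0" "cnj (poly b (cnj z)) \<noteq> 0" using assms ab by auto
  ultimately show ?thesis by (simp add: ab(4) frac_eq_eq)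
qed

lemma eventually_notin_finite_at_infinity:
  fixes S :: "complex set"
  assumes "finite S"
  shows "\<forall>\<^sub>F z in at_infinity. z \<notin> S"
proof -
  obtain B where "\<forall>z\<in>S. norm z \<le> B"
    using finite_imp_bounded[OF assms] unfolding bounded_iff by blast
  then show ?thesis
    by (intro eventually_at_infinityI[of "B + 1"]) force
qed

lemma strictly_proper_real_tendsto:
  assumes "f - rf_const d \<in> strictly_proper_real"
  shows "(rf_eval f \<longlongrightarrow> d) at_infinity"
proof -
  from assms obtain p q where 1: "f - rf_const d = to_fract p / to_fract q"
    "real_poly p" "real_poly q" "degree p < degree q" "q \<noteq> 0"
    by (rule strictly_proper_realE)
  have "\<forall>\<^sub>F z in at_infinity. z \<notin> {z. poly q z = 0}"
    by (intro eventually_notin_finite_at_infinity poly_roots_finite 1)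
  then have "\<forall>\<^sub>F z in at_infinity. poly p z / poly q z + d = rf_eval f z"
  proof eventually_elim
    case (elim z)
    then have "\<not> rf_pole (f - rf_const d) z" "rf_eval (f - rf_const d) z = poly p z / poly q z"
      using not_rf_pole_quotient[OF 1(1)] rf_eval_quotient[OF 1(1)] by auto
    then show ?case
      using rf_eval_add[of "f - rf_const d" z "rf_const d"] by simp
  qed
  moreover have "((\<lambda>z. poly p z / poly q z + d) \<longlongrightarrow> 0 + d) at_infinity"
    by (intro tendsto_add degree_less_imp_tendsto_0 1) simp
  ultimately show ?thesis
    by (auto elim: Lim_transform_eventually)
qed

text \<open>The limit controls the degrees, and the pointwise symmetry becomes a polynomial
  identity. Multiplying numerator and denominator by the conjugate \<open>b'\<close> of the
  denominator then exhibits a real fraction.\<close>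

lemma strictly_proper_realI_eval:
  assumes lim: "(rf_eval f \<longlongrightarrow> d) at_infinity" and "d \<in> \<real>"
    and "finite E" and cnj: "\<And>z. z \<notin> E \<Longrightarrow> cnj (rf_eval f (cnj z)) = rf_eval f z"
  shows "f - rf_const d \<in> strictly_proper_real"
proof -
  obtain a b where ab: "f = to_fract a / to_fract b" "b \<noteq> 0"
    "\<And>z. rf_eval f z = poly a z / poly b z"
    by (rule rf_lowest_terms [of f]) blast
  define p where "p = a - [:d:] * b"
  define b' where "b' = map_poly cnj b"
  have b': "b' \<noteq> 0" using ab by (simp add: b'_def)
  have f: "f - rf_const d = to_fract p / to_fract b"
    unfolding ab(1) p_def to_fract_diff to_fract_mult rf_const_def
    using ab(2) by (simp add: diff_divide_distrib)
  have fin: "finite {z. poly b z = 0}" "finite {z. poly b' z = 0}"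
    using ab(2) b' by (simp_all add: poly_roots_finite)
  have ev: "poly p z / poly b z = rf_eval f z - d" if "poly b z \<noteq> 0" for z
    using that by (simp add: p_def ab(3) diff_divide_distrib)
  have deg: "p = 0 \<or> degree p < degree b"
  proof -
    have "((\<lambda>z. rf_eval f z - d) \<longlongrightarrow> d - d) at_infinity"
      by (intro tendsto_diff lim tendsto_const)
    moreover have "\<forall>\<^sub>F z in at_infinity. rf_eval f z - d = poly p z / poly b z"
      using eventually_notin_finite_at_infinity[OF fin(1)] by eventually_elim (simp add: ev)
    ultimately have "((\<lambda>z. poly p z / poly b z) \<longlongrightarrow> 0) at_infinity"
      by (auto elim: Lim_transform_eventually)
    then show ?thesis using tendsto_0_imp_degree_less ab(2) by blast
  qed
  have "map_poly cnj p * b = p * b'"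
  proof (rule ccontr)
    assume neq: "map_poly cnj p * b \<noteq> p * b'"
    let ?r = "map_poly cnj p * b - p * b'"
    \<comment> \<open>Off finitely many exceptional points the symmetry makes \<open>?r\<close>
      vanish. Were \<open>?r\<close> nonzero, its roots would be finite in number and the whole
      plane would be a finite set.\<close>
    have "z \<in> E \<union> {z. poly b z = 0} \<union> {z. poly b' z = 0} \<union> {z. poly ?r z = 0}" for z
    proof (cases "z \<in> E \<or> poly b z = 0 \<or> poly b' z = 0")
      case False
      then have nz: "poly b z \<noteq> 0" "poly b (cnj z) \<noteq> 0" by (auto simp: b'_def)
      have "cnj (poly p (cnj z) / poly b (cnj z)) = poly p z / poly b z"
        using cnj[of z] False nz \<open>d \<in> \<real>\<close> by (simp add: ev Reals_cnj_iff)
      then have "poly ?r z = 0"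
        using nz by (simp add: b'_def frac_eq_eq)
      then show ?thesis by simp
    qed auto
    then have "UNIV = E \<union> {z. poly b z = 0} \<union> {z. poly b' z = 0} \<union> {z. poly ?r z = 0}"
      by blast
    moreover have "finite {z. poly ?r z = 0}"
      using neq by (intro poly_roots_finite) auto
    ultimately have "finite (UNIV :: complex set)"
      using fin \<open>finite E\<close> by (metis finite_UnI)
    then show False by (simp add: infinite_UNIV_char_0)
  qed
  \<comment> \<open>The conjugate of \<open>p * b'\<close> is \<open>map_poly cnj p * b\<close>,
    which by the identity just shown is \<open>p * b'\<close> again.\<close>
  then have "real_poly (p * b')"
    by (simp add: real_poly_def map_poly_cnj_mult b'_def map_poly_cnj_map_poly_cnj)
  moreover have "real_poly (b * b')"
    unfolding b'_def by (rule real_poly_conj_mult)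
  moreover have "f - rf_const d = to_fract (p * b') / to_fract (b * b')"
    unfolding f using b' by simp
  moreover have "p \<noteq> 0 \<Longrightarrow> degree (p * b') < degree (b * b')"
    using deg b' ab(2) by (simp add: degree_mult_eq)
  ultimately show ?thesis
    by (metis strictly_proper_realI f to_fract_0 div_0 strictly_proper_real_0)
qed

subsection \<open>Loops as matrices congruent to the identity at infinity\<close>

definition near_identity :: "('n::finite loop) set" where
  "near_identity = {g. \<forall>i j. (g - mat 1) $ i $ j \<in> strictly_proper_real}"

lemma mat_1_rf_const: "(mat 1 :: 'n::finite loop) $ i $ j = rf_const ((mat 1 :: complex^'n^'n) $ i $ j)"
  by (simp add: mat_def)

lemma mat_1_real: "(mat 1 :: complex^'n^'n) $ i $ j \<in> \<real>"
  by (simp add: mat_def)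

lemma near_identityD:
  fixes g :: "'n::finite loop"
  assumes "g \<in> near_identity"
  shows "g $ i $ j - rf_const ((mat 1 :: complex^'n^'n) $ i $ j) \<in> strictly_proper_real"
  using assms by (simp add: near_identity_def mat_1_rf_const)

lemma
  fixes g :: "'n::finite loop"
  shows near_identity_diagonal: "g \<in> near_identity \<Longrightarrow> g $ k $ k - 1 \<in> strictly_proper_real"
  and near_identity_off_diagonal: "g \<in> near_identity \<Longrightarrow> i \<noteq> j \<Longrightarrow> g $ i $ j \<in> strictly_proper_real"
  using near_identityD[of g k k] near_identityD[of g i j] by (simp_all add: mat_def)

lemma near_identityI:
  fixes g :: "'n::finite loop"
  assumes "\<And>i. g $ i $ i - 1 \<in> strictly_proper_real"
    and "\<And>i j. i \<noteq> j \<Longrightarrow> g $ i $ j \<in> strictly_proper_real"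
  shows "g \<in> near_identity"
  using assms by (auto simp: near_identity_def mat_def)

lemma near_identity_one: "mat 1 \<in> near_identity"
  by (simp add: near_identity_def)

lemma matrix_add_rdistrib:
  fixes A B :: "'a::semiring_1^'n^'m"
  shows "(A + B) ** C = A ** C + B ** C"
  by (simp add: vec_eq_iff matrix_matrix_mult_def distrib_right sum.distrib)

text \<open>With g = 1 + A and h = 1 + B the product is 1 + AB + A + B, and the entries of AB + A +
  B stay in the ideal.\<close>

lemma near_identity_mult:
  assumes "g \<in> near_identity" "h \<in> near_identity"
  shows "g ** h \<in> near_identity"
proof -
  have "((g - mat 1) + mat 1) ** ((h - mat 1) + mat 1)
      = (g - mat 1) ** (h - mat 1) + (g - mat 1) + (h - mat 1) + mat 1"
    by (simp only: matrix_add_ldistrib matrix_add_rdistrib matrix_mul_lid matrix_mul_rid add_ac)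
  then have "g ** h - mat 1 = (g - mat 1) ** (h - mat 1) + (g - mat 1) + (h - mat 1)"
    by simp
  then have "(g ** h - mat 1) $ i $ j
      = (\<Sum>l\<in>UNIV. (g - mat 1) $ i $ l * (h - mat 1) $ l $ j) + (g - mat 1) $ i $ j + (h - mat 1) $ i $ j"
    for i j
    by (simp only: matrix_matrix_mult_def vector_add_component vec_lambda_beta)
  then show ?thesis
    using assms unfolding near_identity_def
    by (auto intro!: strictly_proper_real_add strictly_proper_real_sum strictly_proper_real_mult
        simp del: vector_minus_component)
qed

section \<open>Elimination matrices, dilations and transvections\<close>

definition replace_column :: "'n \<Rightarrow> ('n \<Rightarrow> ratfun) \<Rightarrow> 'n::finite loop" where
  "replace_column k v = (\<chi> i j. if j = k then v i else if i = j then 1 else 0)"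

text \<open>Left multiplication is a row operation with pivot row \<open>k\<close>. Dilations,
  transvections and the clearing of a whole column are all instances, so this one formula serves for
  every product below.\<close>

lemma replace_column_mult:
  "(replace_column k v ** M) $ i $ j = (if i = k then 0 else M $ i $ j) + v i * M $ k $ j"
proof -
  have "(replace_column k v ** M) $ i $ j
      = (\<Sum>l\<in>UNIV. (if l = k then v i else if i = l then 1 else 0) * M $ l $ j)"
    by (simp add: matrix_matrix_mult_def replace_column_def)
  also have "\<dots> = v i * M $ k $ j
      + (\<Sum>l\<in>UNIV - {k}. (if l = k then v i else if i = l then 1 else 0) * M $ l $ j)"
    by (subst sum.remove[of _ k]) auto
  also have "(\<Sum>l\<in>UNIV - {k}. (if l = k then v i else if i = l then 1 else 0) * M $ l $ j)
      = (\<Sum>l\<in>UNIV - {k}. if i = l then M $ l $ j else 0)"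
    by (rule sum.cong) auto
  also have "\<dots> = (if i = k then 0 else M $ i $ j)"
    by (simp add: sum.delta)
  finally show ?thesis by simp
qed

definition dilation :: "'n \<Rightarrow> ratfun \<Rightarrow> 'n::finite loop" where
  "dilation k u = replace_column k (\<lambda>i. if i = k then u else 0)"

definition transvection :: "'n \<Rightarrow> 'n \<Rightarrow> ratfun \<Rightarrow> 'n::finite loop" where
  "transvection i k c = replace_column k (\<lambda>l. if l = k then 1 else if l = i then c else 0)"

lemma dilation_mult: "dilation k u ** dilation k w = dilation k (u * w)"
  by (simp add: vec_eq_iff dilation_def replace_column_mult) (simp add: replace_column_def)

lemma dilation_one: "dilation k 1 = mat 1"
  by (simp add: vec_eq_iff dilation_def replace_column_def mat_def)

lemma transvection_mult:
  "i \<noteq> k \<Longrightarrow> transvection i k c ** transvection i k d = transvection i k (c + d)"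
  by (simp add: vec_eq_iff transvection_def replace_column_mult) (simp add: replace_column_def)

lemma transvection_zero: "transvection i k 0 = mat 1"
  by (simp add: vec_eq_iff transvection_def replace_column_def mat_def)

text \<open>Conjugation by a diagonal matrix rescales an off-diagonal entry; this later turns a
  monomial entry into an arbitrary one.\<close>

lemma dilation_transvection_dilation:
  assumes "i \<noteq> k" "u \<noteq> 0"
  shows "dilation i u ** (transvection i k c ** dilation i (1 / u)) = transvection i k (u * c)"
  using assms
  by (simp add: vec_eq_iff dilation_def transvection_def replace_column_mult)
     (simp add: replace_column_def)

lemma dilation_near_identity: "u - 1 \<in> strictly_proper_real \<Longrightarrow> dilation k u \<in> near_identity"
  by (rule near_identityI) (auto simp: dilation_def replace_column_def)

lemma transvection_near_identity:
  "i \<noteq> k \<Longrightarrow> c \<in> strictly_proper_real \<Longrightarrow> transvection i k c \<in> near_identity"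
  by (rule near_identityI) (auto simp: transvection_def replace_column_def)

text \<open>The column is filled entry by entry: a dilation supplies the diagonal entry, and each
  further entry costs one transvection. \<open>S\<close> is the set of off-diagonal positions
  already filled.\<close>

lemma replace_column_induct:
  assumes v: "v k - 1 \<in> strictly_proper_real" "\<And>i. i \<noteq> k \<Longrightarrow> v i \<in> strictly_proper_real"
    and mult: "\<And>A B. P A \<Longrightarrow> P B \<Longrightarrow> P (A ** B)"
    and dil: "\<And>k u. u - 1 \<in> strictly_proper_real \<Longrightarrow> P (dilation k u)"
    and trans: "\<And>i k c. i \<noteq> k \<Longrightarrow> c \<in> strictly_proper_real \<Longrightarrow> P (transvection i k c)"
  shows "P (replace_column k v)"
proof -
  have "P (replace_column k (\<lambda>i. if i = k \<or> i \<in> S then v i else 0))" if "k \<notin> S" for S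
    using finite[of S] that
  proof (induction S)
    case empty
    have "(\<lambda>i. if i = k \<or> i \<in> {} then v i else 0) = (\<lambda>i. if i = k then v k else 0)" by auto
    then show ?case using dil[OF v(1)] by (simp add: dilation_def)
  next
    case (insert i S)
    \<comment> \<open>The transvection stands on the right, where it adds \<open>v i\<close> times
      column \<open>i\<close> to column \<open>k\<close>. Column \<open>i\<close> is still a unit
      vector, so \<open>v i\<close> enters without a factor \<open>v k\<close>.\<close>
    have "replace_column k (\<lambda>i. if i = k \<or> i \<in> S then v i else 0) ** transvection i k (v i)
        = replace_column k (\<lambda>l. if l = k \<or> l \<in> insert i S then v l else 0)"
      using insert
      by (simp add: vec_eq_iff replace_column_mult) (auto simp: replace_column_def transvection_def)
    with insert show ?case
      using mult[OF insert.IH trans[of i k "v i"]] v(2)[of i] by auto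
  qed
  from this[of "- {k}"] show ?thesis by (simp cong: if_cong)
qed

text \<open>
  Gaussian elimination, one column at a time; no pivoting is needed, since the diagonal entries
  stay units throughout.
\<close>

lemma near_identity_induct [consumes 1, case_names one mult dilation transvection]:
  fixes g :: "'n::finite loop"
  assumes g: "g \<in> near_identity"
    and one: "P (mat 1)"
    and mult: "\<And>A B. P A \<Longrightarrow> P B \<Longrightarrow> P (A ** B)"
    and dil: "\<And>k u. u - 1 \<in> strictly_proper_real \<Longrightarrow> P (dilation k u)"
    and trans: "\<And>i k c. i \<noteq> k \<Longrightarrow> c \<in> strictly_proper_real \<Longrightarrow> P (transvection i k c)"
  shows "P g"
proof -
  \<comment> \<open>\<open>S\<close> collects the columns that may still differ from those of the
    identity.\<close>
  have "P g" if "g \<in> near_identity" "\<And>i j. j \<notin> S \<Longrightarrow> g $ i $ j = (if i = j then 1 else 0)" for S and g :: "'n loop"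
    using finite[of S] that
  proof (induction S arbitrary: g)
    case empty
    then have "g = mat 1" by (simp add: vec_eq_iff mat_def)
    then show ?case using one by simp
  next
    case (insert k S)
    define u where "u = g $ k $ k"
    \<comment> \<open>These are the row operations that turn column \<open>k\<close> of
      \<open>g\<close> into a unit vector: scale the pivot row by \<open>1 / u\<close> and clear the
      other entries.\<close>
    define w where "w i = (if i = k then 1 / u else - g $ i $ k / u)" for i
    define h where "h = replace_column k w ** g"
    have u: "u - 1 \<in> strictly_proper_real"
      unfolding u_def using insert.prems(1) by (rule near_identity_diagonal)
    then have u0: "u \<noteq> 0" by (rule one_plus_strictly_proper_nonzero)
    have u': "1 / u - 1 \<in> strictly_proper_real"
      by (rule one_plus_strictly_proper_inverse[OF u])
    have w: "w i \<in> strictly_proper_real" if "i \<noteq> k" for i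
    proof -
      have *: "- g $ i $ k \<in> strictly_proper_real"
        using near_identity_off_diagonal[OF insert.prems(1) that] by (rule strictly_proper_real_uminus)
      \<comment> \<open>Splitting \<open>1 / u\<close> as \<open>(1 / u - 1) + 1\<close> writes the
        quotient through elements of the ideal.\<close>
      have "- g $ i $ k * (1 / u - 1) + - g $ i $ k \<in> strictly_proper_real"
        by (intro strictly_proper_real_add strictly_proper_real_mult * u')
      then show ?thesis using that by (simp add: w_def algebra_simps)
    qed
    have "replace_column k w \<in> near_identity"
      by (rule near_identityI) (use w u' in \<open>auto simp: replace_column_def w_def\<close>)
    then have h: "h \<in> near_identity"
      unfolding h_def using insert.prems(1) by (rule near_identity_mult)
    \<comment> \<open>Column \<open>k\<close> has just been cleared. Any other column outside
      \<open>S\<close> is a unit vector with entry 0 in the pivot row, so the row operations leave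
      it alone.\<close>
    have "h $ i $ j = (if i = j then 1 else 0)" if "j \<notin> S" for i j
      using that u0 insert.prems(2)[of j i] insert.prems(2)[of j k]
      by (cases "j = k") (auto simp: h_def replace_column_mult w_def u_def)
    then have "P h" using insert.IH[OF h] by blast
    moreover have "P (replace_column k (\<lambda>i. g $ i $ k))"
      by (rule replace_column_induct)
        (use near_identity_diagonal near_identity_off_diagonal insert.prems(1) mult dil trans in auto)
    \<comment> \<open>Putting back the original column \<open>k\<close> inverts the elimination
      matrix built from \<open>w\<close>.\<close>
    moreover have "g = replace_column k (\<lambda>i. g $ i $ k) ** h"
      using u0 by (auto simp: vec_eq_iff replace_column_mult h_def w_def u_def)
    ultimately show ?case using mult by metis
  qed
  from this[of g UNIV] g show ?thesis by simp
qed

text \<open>Elementary factors have explicit inverses of the same kind, and a product is inverted in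
  reverse order. This supplies both the group inverses and the invertibility of the values.\<close>

lemma near_identity_left_inverse:
  assumes "g \<in> near_identity"
  shows "\<exists>h\<in>near_identity. h ** g = mat 1"
  using assms
proof (induction rule: near_identity_induct)
  case one
  then show ?case using near_identity_one by (intro bexI[of _ "mat 1"]) auto
next
  case (mult A B)
  then obtain A' B' where "A' \<in> near_identity" "A' ** A = mat 1"
    "B' \<in> near_identity" "B' ** B = mat 1" by blast
  moreover have "(B' ** A') ** (A ** B) = B' ** ((A' ** A) ** B)"
    by (simp only: matrix_mul_assoc)
  ultimately show ?case
    by (intro bexI[of _ "B' ** A'"] near_identity_mult) simp_all
next
  case (dilation k u)
  then show ?case
    by (intro bexI[of _ "dilation k (1 / u)"] dilation_near_identity one_plus_strictly_proper_inverse)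
      (use one_plus_strictly_proper_nonzero in \<open>simp_all add: dilation_mult dilation_one\<close>)
next
  case (transvection i k c)
  then show ?case
    by (intro bexI[of _ "transvection i k (- c)"] transvection_near_identity strictly_proper_real_uminus)
      (simp_all add: transvection_mult transvection_zero)
qed

section \<open>The carrier and its group structure\<close>

lemma loop_eval_nth: "loop_eval g z $ i $ j = rf_eval (g $ i $ j) z"
  by (simp add: loop_eval_def map_matrix_def)

lemma near_identity_subset_carrier: "near_identity \<subseteq> carrier real_negative_loops"
proof
  fix g :: "'n::finite loop"
  assume g: "g \<in> near_identity"
  then obtain h where h: "h ** g = mat 1" using near_identity_left_inverse by blast
  \<comment> \<open>Away from the poles of both loops evaluation is multiplicative, so the value of
    \<open>h\<close> is a left inverse of the value of \<open>g\<close>.\<close>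
  have "invertible (loop_eval g z)" if "\<not> loop_pole g z" "\<not> loop_pole h z" for z
    unfolding invertible_left_inverse
    using loop_eval_mult[OF that(2,1)] by (auto simp: h loop_eval_mat_1)
  then have "{z. loop_pole g z \<or> \<not> invertible (loop_eval g z)} \<subseteq> {z. loop_pole g z} \<union> {z. loop_pole h z}"
    by auto
  then have "rational_loop g"
    unfolding rational_loop_def using finite_loop_poles by (meson finite_UnI finite_subset)
  moreover have "negative_loop g"
    unfolding negative_loop_def
    by (intro vec_tendstoI) (simp add: loop_eval_nth strictly_proper_real_tendsto near_identityD[OF g])
  moreover have "reality_condition g"
    unfolding reality_condition_def vec_eq_iff
    using strictly_proper_real_eval_cnj[OF near_identityD[OF g] mat_1_real]
    by (auto simp: map_matrix_def loop_eval_nth loop_pole_def)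
  ultimately show "g \<in> carrier real_negative_loops"
    by (simp add: real_negative_loops_def)
qed

lemma carrier_subset_near_identity: "carrier real_negative_loops \<subseteq> near_identity"
proof
  fix g :: "'n::finite loop"
  assume "g \<in> carrier real_negative_loops"
  then have neg: "negative_loop g" and real: "reality_condition g"
    by (auto simp: real_negative_loops_def)
  \<comment> \<open>The reality condition speaks only of points where neither \<open>z\<close> nor
    \<open>cnj z\<close> is a pole, so the conjugates of the poles are excluded as well.\<close>
  define E where "E = {z. loop_pole g z} \<union> cnj ` {z. loop_pole g z}"
  have "finite E" by (simp add: E_def finite_loop_poles)
  moreover have "cnj (rf_eval (g $ i $ j) (cnj z)) = rf_eval (g $ i $ j) z" if "z \<notin> E" for z i j
  proof -
    have "\<not> loop_pole g z" "\<not> loop_pole g (cnj z)"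
      using that unfolding E_def by (auto simp: image_iff)
    with real have "map_matrix cnj (loop_eval g (cnj z)) = loop_eval g z"
      by (auto simp: reality_condition_def)
    from arg_cong[OF this, of "\<lambda>A. A $ i $ j"] show ?thesis
      by (simp add: map_matrix_def loop_eval_nth)
  qed
  moreover have "(rf_eval (g $ i $ j) \<longlongrightarrow> (mat 1 :: complex^'n^'n) $ i $ j) at_infinity" for i j
    using tendsto_vec_nth[OF tendsto_vec_nth[OF neg[unfolded negative_loop_def], of i], of j]
    by (simp add: loop_eval_nth)
  ultimately have "g $ i $ j - rf_const ((mat 1 :: complex^'n^'n) $ i $ j) \<in> strictly_proper_real" for i j
    using mat_1_real by (intro strictly_proper_realI_eval[of _ _ E]) blast+
  then show "g \<in> near_identity"
    by (simp add: near_identity_def mat_1_rf_const)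
qed

lemma carrier_real_negative_loops: "carrier real_negative_loops = near_identity"
  using near_identity_subset_carrier carrier_subset_near_identity by blast

text \<open>\<open>groupI\<close> asks for left inverses only, and elimination provides
  them.\<close>

lemma group_real_negative_loops: "group real_negative_loops"
proof (rule groupI)
  fix x y z :: "'a loop"
  let ?G = "real_negative_loops :: 'a loop monoid"
  have simps: "mult ?G = (**)" "one ?G = mat 1" by (simp_all add: real_negative_loops_def)
  show "\<one>\<^bsub>?G\<^esub> \<in> carrier ?G"
    by (simp add: carrier_real_negative_loops simps near_identity_one)
  show "x \<otimes>\<^bsub>?G\<^esub> y \<otimes>\<^bsub>?G\<^esub> z = x \<otimes>\<^bsub>?G\<^esub> (y \<otimes>\<^bsub>?G\<^esub> z)" "\<one>\<^bsub>?G\<^esub> \<otimes>\<^bsub>?G\<^esub> x = x"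
    by (simp_all add: simps matrix_mul_assoc)
  assume x: "x \<in> carrier ?G"
  show "\<exists>y\<in>carrier ?G. y \<otimes>\<^bsub>?G\<^esub> x = \<one>\<^bsub>?G\<^esub>"
    using x near_identity_left_inverse by (simp add: carrier_real_negative_loops simps)
  show "x \<otimes>\<^bsub>?G\<^esub> y \<in> carrier ?G" if "y \<in> carrier ?G"
    using x that by (simp add: carrier_real_negative_loops simps near_identity_mult)
qed

subsection \<open>The four families of generators\<close>

lemma map_poly_cnj_linear [simp]: "map_poly cnj [:a, b:] = [:cnj a, cnj b:]"
  by (simp add: map_poly_pCons)

lemma rf_var_minus_const: "rf_var - rf_const a = to_fract [:- a, 1:]"
  by (simp add: rf_var_def rf_const_def flip: to_fract_diff)

lemma linear_quotient:
  "(rf_var - rf_const \<alpha>) / (rf_var - rf_const \<beta>) = to_fract [:- \<alpha>, 1:] / to_fract [:- \<beta>, 1:]"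
  by (simp only: rf_var_minus_const)

lemma quadratic_quotient:
  "((rf_var - rf_const \<alpha>) * (rf_var - rf_const (cnj \<alpha>)))
      / ((rf_var - rf_const \<beta>) * (rf_var - rf_const (cnj \<beta>)))
    = to_fract ([:- \<alpha>, 1:] * map_poly cnj [:- \<alpha>, 1:])
      / to_fract ([:- \<beta>, 1:] * map_poly cnj [:- \<beta>, 1:])"
  by (simp only: rf_var_minus_const to_fract_mult map_poly_cnj_linear complex_cnj_minus complex_cnj_one)

lemma scaled_loop_nth: "scaled_loop f A $ i $ j = f * rf_const (A $ i $ j)"
  by (simp add: scaled_loop_def map_matrix_def)

lemma const_loop_nth: "const_loop A $ i $ j = rf_const (A $ i $ j)"
  by (simp add: const_loop_def map_matrix_def)

lemma cnj_vec_nth [simp]: "cnj_vec v $ i = cnj (v $ i)"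
  by (simp add: cnj_vec_def)

lemma cnj_vec_add: "cnj_vec (v + w) = cnj_vec v + cnj_vec w"
  by (simp add: vec_eq_iff)

lemma cnj_vec_cnj_vec [simp]: "cnj_vec (cnj_vec v) = v"
  by (simp add: vec_eq_iff)

lemma cnj_vec_axis [simp]: "cnj_vec (axis j 1) = axis j 1"
  by (simp add: vec_eq_iff axis_def)

lemma axis_nth_mat: "(axis j 1 :: complex^'n) $ i = (mat 1 :: complex^'n^'n) $ i $ j"
  by (simp add: axis_def mat_def)

text \<open>Trades the definite description for an actual decomposition \<open>us\<close> of a basis
  vector, whose components are the columns with index \<open>j\<close> of the projections.\<close>

lemma proj_mat_nth:
  assumes "direct_decomp Us"
  obtains us where "decomposes Us (axis j 1) us"
    "\<And>vs. decomposes Us (axis j 1) vs \<Longrightarrow> vs = us"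
    "\<And>k i. proj_mat Us k $ i $ j = us ! k $ i"
proof -
  from assms have ex1: "\<exists>!us. decomposes Us (axis j 1) us"
    by (simp add: direct_decomp_def)
  show ?thesis
    by (rule that[OF theI'[OF ex1]]) (use ex1 theI'[OF ex1] in \<open>auto simp: proj_mat_def matrix_def\<close>)
qed

text \<open>Conjugation fixes the basis vectors and preserves \<open>V\<close> and \<open>W\<close>,
  so by uniqueness it fixes the components of a basis vector.\<close>

lemma proj_mat_pair:
  assumes "direct_decomp [V, W]" "cnj_vec ` V = V" "cnj_vec ` W = W"
  shows "proj_mat [V, W] 0 $ i $ j + proj_mat [V, W] 1 $ i $ j = mat 1 $ i $ j"
    and "proj_mat [V, W] 0 $ i $ j \<in> \<real>"
proof -
  obtain us where us: "decomposes [V, W] (axis j 1) us"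
    "\<And>vs. decomposes [V, W] (axis j 1) vs \<Longrightarrow> vs = us"
    "\<And>k i. proj_mat [V, W] k $ i $ j = us ! k $ i"
    by (rule proj_mat_nth[OF assms(1)]) blast
  from us(1) obtain v w where vw: "us = [v, w]" "v \<in> V" "w \<in> W" "v + w = axis j 1"
    by (auto simp: decomposes_def list_all2_Cons2)
  have "cnj_vec v + cnj_vec w = axis j 1"
    using vw(4) by (simp flip: cnj_vec_add)
  then have "decomposes [V, W] (axis j 1) [cnj_vec v, cnj_vec w]"
    using vw(2,3) assms(2,3) by (auto simp: decomposes_def)
  then have "cnj_vec v = v" using us(2) vw(1) by auto
  then have "cnj (v $ i) = v $ i" by (metis cnj_vec_nth)
  then show "proj_mat [V, W] 0 $ i $ j \<in> \<real>"
    by (simp add: us(3) vw(1) Reals_cnj_iff)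
  show "proj_mat [V, W] 0 $ i $ j + proj_mat [V, W] 1 $ i $ j = mat 1 $ i $ j"
    using arg_cong[OF vw(4), of "\<lambda>x. x $ i"] by (simp add: us(3) vw(1) flip: axis_nth_mat)
qed

text \<open>Conjugation exchanges the outer two subspaces and preserves \<open>W\<close>. The
  conjugated components in reverse order decompose the same basis vector, and uniqueness identifies
  them.\<close>

lemma proj_mat_triple:
  assumes "direct_decomp [V, W, cnj_vec ` V]" "cnj_vec ` W = W"
  shows "proj_mat [V, W, cnj_vec ` V] 0 $ i $ j + proj_mat [V, W, cnj_vec ` V] 1 $ i $ j
      + proj_mat [V, W, cnj_vec ` V] 2 $ i $ j = mat 1 $ i $ j" (is ?sum)
    and "proj_mat [V, W, cnj_vec ` V] 2 $ i $ j = cnj (proj_mat [V, W, cnj_vec ` V] 0 $ i $ j)"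
      (is ?cnj)
proof -
  let ?Us = "[V, W, cnj_vec ` V]"
  obtain us where us: "decomposes ?Us (axis j 1) us"
    "\<And>vs. decomposes ?Us (axis j 1) vs \<Longrightarrow> vs = us"
    "\<And>k i. proj_mat ?Us k $ i $ j = us ! k $ i"
    by (rule proj_mat_nth[OF assms(1)]) blast
  from us(1) obtain v w v' where vw: "us = [v, w, v']" "v \<in> V" "w \<in> W" "v' \<in> cnj_vec ` V"
      "v + (w + v') = axis j 1"
    by (auto simp: decomposes_def list_all2_Cons2)
  have "cnj_vec (v + (w + v')) = axis j 1" by (simp add: vw(5))
  then have "cnj_vec v' + (cnj_vec w + cnj_vec v) = axis j 1"
    by (simp add: cnj_vec_add add_ac)
  moreover have "cnj_vec v' \<in> V" "cnj_vec w \<in> W" using vw assms(2) by auto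
  ultimately have "decomposes ?Us (axis j 1) [cnj_vec v', cnj_vec w, cnj_vec v]"
    using vw(2) by (auto simp: decomposes_def)
  then have "cnj_vec v = v'" using us(2) vw(1) by auto
  then show ?cnj
    by (simp add: us(3) vw(1) flip: cnj_vec_nth)
  show ?sum
    using arg_cong[OF vw(5), of "\<lambda>x. x $ i"]
    by (simp add: us(3) vw(1) add.assoc flip: axis_nth_mat)
qed

section \<open>Membership of the four families in the group\<close>

lemma scaled_plus_const_near_identity:
  fixes A B :: "complex^'n::finite^'n"
  assumes "f - 1 \<in> strictly_proper_real" "\<And>i j. A $ i $ j + B $ i $ j = mat 1 $ i $ j"
    and "\<And>i j. A $ i $ j \<in> \<real>"
  shows "scaled_loop f A + const_loop B \<in> near_identity"
proof -
  \<comment> \<open>Replacing the identity by A + B cancels B and leaves (f - 1) A.\<close>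
  have "(scaled_loop f A + const_loop B - mat 1) $ i $ j = (f - 1) * rf_const (A $ i $ j)" for i j
    by (simp add: scaled_loop_nth const_loop_nth mat_1_rf_const rf_const_add algebra_simps
        flip: assms(2))
  then show ?thesis
    using assms by (simp add: near_identity_def strictly_proper_real_scale)
qed

lemma p_loops_near_identity: "p_loops \<subseteq> near_identity"
proof -
  have "(rf_var - rf_const \<alpha>) / (rf_var - rf_const \<beta>) - 1 \<in> strictly_proper_real"
    if "\<alpha> \<in> \<real>" "\<beta> \<in> \<real>" for \<alpha> \<beta>
    unfolding linear_quotient using that by (intro one_plus_strictly_properI) auto
  then show ?thesis
    unfolding p_loops_def p_loop_def
    by (auto intro!: scaled_plus_const_near_identity simp: proj_mat_pair[simplified])
qed

lemma q_loops_near_identity: "q_loops \<subseteq> near_identity"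
proof -
  have "((rf_var - rf_const \<alpha>) * (rf_var - rf_const (cnj \<alpha>)))
      / ((rf_var - rf_const \<beta>) * (rf_var - rf_const (cnj \<beta>))) - 1 \<in> strictly_proper_real" for \<alpha> \<beta>
    unfolding quadratic_quotient by (intro one_plus_strictly_properI real_poly_conj_mult) auto
  then show ?thesis
    unfolding q_loops_def q_loop_def
    by (auto intro!: scaled_plus_const_near_identity simp: proj_mat_pair[simplified])
qed

text \<open>The two summands are conjugate to each other. Over the common denominator, which is real
  of degree 2, the numerator is a polynomial \<open>p\<close> of degree at most 1 plus its
  conjugate, hence real.\<close>

lemma conj_pair_strictly_proper:
  "((rf_var - rf_const \<alpha>) / (rf_var - rf_const \<beta>) - 1) * rf_const c
   + ((rf_var - rf_const (cnj \<alpha>)) / (rf_var - rf_const (cnj \<beta>)) - 1) * rf_const (cnj c)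
   \<in> strictly_proper_real"
proof -
  define p where "p = [:(\<beta> - \<alpha>) * c:] * map_poly cnj [:- \<beta>, 1:]"
  have *: "((rf_var - rf_const \<alpha>) / (rf_var - rf_const \<beta>) - 1) * rf_const c
      = to_fract [:(\<beta> - \<alpha>) * c:] / to_fract [:- \<beta>, 1:]" for \<alpha> \<beta> c
  proof -
    have "(rf_var - rf_const \<alpha>) / (rf_var - rf_const \<beta>) - 1
        = to_fract ([:- \<alpha>, 1:] - [:- \<beta>, 1:]) / to_fract [:- \<beta>, 1:]"
      unfolding linear_quotient to_fract_diff by (simp add: diff_divide_distrib)
    also have "[:- \<alpha>, 1:] - [:- \<beta>, 1:] = [:\<beta> - \<alpha>:]" by simp
    finally show ?thesis
      unfolding rf_const_def by (simp flip: to_fract_mult)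
  qed
  have "to_fract [:(\<beta> - \<alpha>) * c:] / to_fract [:- \<beta>, 1:]
      + to_fract [:(cnj \<beta> - cnj \<alpha>) * cnj c:] / to_fract [:- cnj \<beta>, 1:]
      = to_fract (p + map_poly cnj p) / to_fract ([:- \<beta>, 1:] * map_poly cnj [:- \<beta>, 1:])"
  proof -
    have cnj_p: "map_poly cnj p = [:(cnj \<beta> - cnj \<alpha>) * cnj c:] * [:- \<beta>, 1:]"
      by (simp add: p_def map_poly_cnj_mult map_poly_pCons)
    show ?thesis
      unfolding cnj_p unfolding p_def map_poly_cnj_linear complex_cnj_minus complex_cnj_one
        to_fract_add to_fract_mult
      by (rule add_frac_eq) auto
  qed
  moreover have "degree p \<le> 1"
    unfolding p_def by simp
  then have "degree (p + map_poly cnj p) \<le> 1" by (intro degree_add_le) auto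
  then have "degree (p + map_poly cnj p) < degree ([:- \<beta>, 1:] * map_poly cnj [:- \<beta>, 1:])"
    by simp
  ultimately show ?thesis
    unfolding * by (rule strictly_proper_realI[OF _ real_poly_conj_add real_poly_conj_mult])
qed

lemma r_loops_near_identity: "r_loops \<subseteq> near_identity"
proof
  fix g :: "'n::finite loop"
  assume "g \<in> r_loops"
  then obtain \<alpha> \<beta> V W where g: "g = r_loop \<alpha> \<beta> V W"
    and dd: "direct_decomp [V, W, cnj_vec ` V]" "cnj_vec ` W = W"
    by (auto simp: r_loops_def)
  let ?P = "\<lambda>k i j. proj_mat [V, W, cnj_vec ` V] k $ i $ j"
  \<comment> \<open>Writing the identity as the sum of the three projections cancels the projection
    onto \<open>W\<close> and leaves a conjugate pair.\<close>
  have "(g - mat 1) $ i $ j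
      = ((rf_var - rf_const \<alpha>) / (rf_var - rf_const \<beta>) - 1) * rf_const (?P 0 i j)
   + ((rf_var - rf_const (cnj \<alpha>)) / (rf_var - rf_const (cnj \<beta>)) - 1) * rf_const (cnj (?P 0 i j))" for i j
    unfolding g r_loop_def Let_def
    by (simp add: scaled_loop_nth const_loop_nth mat_1_rf_const rf_const_add left_diff_distrib
        flip: proj_mat_triple[OF dd])
  then have "(g - mat 1) $ i $ j \<in> strictly_proper_real" for i j
    using conj_pair_strictly_proper by (simp only:)
  then show "g \<in> near_identity"
    unfolding near_identity_def by blast
qed

lemma inverse_linear_power: "(1 / (rf_var - rf_const \<alpha>)) ^ k = 1 / to_fract ([:- \<alpha>, 1:] ^ k)"
proof -
  have "to_fract (p ^ k) = to_fract p ^ k" for p :: "complex poly"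
    by (induction k) auto
  then show ?thesis
    unfolding rf_var_minus_const by (simp add: power_divide)
qed

lemma m_loops_near_identity: "m_loops \<subseteq> near_identity"
proof
  fix g :: "'n::finite loop"
  assume "g \<in> m_loops"
  then obtain \<alpha> k N where g: "g = m_loop \<alpha> k N" and "\<alpha> \<in> \<real>" "0 < k" "map_matrix cnj N = N"
    by (auto simp: m_loops_def)
  have "(1 / (rf_var - rf_const \<alpha>)) ^ k \<in> strictly_proper_real"
    by (rule strictly_proper_realI[of _ 1 "[:- \<alpha>, 1:] ^ k"])
      (use \<open>\<alpha> \<in> \<real>\<close> \<open>0 < k\<close> in \<open>auto simp: inverse_linear_power degree_linear_power intro: real_poly_power\<close>)
  moreover have "N $ i $ j \<in> \<real>" for i j
    using arg_cong[OF \<open>map_matrix cnj N = N\<close>, of "\<lambda>A. A $ i $ j"]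
    by (simp add: map_matrix_def Reals_cnj_iff)
  ultimately show "g \<in> near_identity"
    by (simp add: near_identity_def g m_loop_def scaled_loop_nth strictly_proper_real_scale)
qed

section \<open>Splittings into a coordinate line and a coordinate hyperplane\<close>

definition coord_line :: "'n \<Rightarrow> (complex^'n::finite) set" where
  "coord_line k = {v. \<forall>i. i \<noteq> k \<longrightarrow> v $ i = 0}"

definition coord_hyperplane :: "'n \<Rightarrow> (complex^'n::finite) set" where
  "coord_hyperplane k = {v. v $ k = 0}"

lemma decomposes_coord:
  "decomposes [coord_line k, coord_hyperplane k] x us \<longleftrightarrow>
    us = [\<chi> i. if i = k then x $ i else 0, \<chi> i. if i = k then 0 else x $ i]"
proof
  assume "decomposes [coord_line k, coord_hyperplane k] x us"
  then obtain v w where us: "us = [v, w]" and "v \<in> coord_line k" "w \<in> coord_hyperplane k" "v + w = x"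
    by (auto simp: decomposes_def list_all2_Cons2)
  then have "v $ i + w $ i = x $ i" "i \<noteq> k \<Longrightarrow> v $ i = 0" "w $ k = 0" for i
    by (auto simp: coord_line_def coord_hyperplane_def)
  then have "v $ i = (if i = k then x $ i else 0)" "w $ i = (if i = k then 0 else x $ i)" for i
    by (metis add.left_neutral add.right_neutral)+
  then show "us = [\<chi> i. if i = k then x $ i else 0, \<chi> i. if i = k then 0 else x $ i]"
    by (simp add: us vec_eq_iff)
next
  assume "us = [\<chi> i. if i = k then x $ i else 0, \<chi> i. if i = k then 0 else x $ i]"
  then show "decomposes [coord_line k, coord_hyperplane k] x us"
    by (simp add: decomposes_def coord_line_def coord_hyperplane_def vec_eq_iff)
qed

lemma direct_decomp_coord: "direct_decomp [coord_line k, coord_hyperplane k]"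
proof -
  have "vec.subspace (coord_line k)" "vec.subspace (coord_hyperplane k)"
    by (auto simp: vec.subspace_def coord_line_def coord_hyperplane_def)
  then show ?thesis by (simp add: direct_decomp_def decomposes_coord)
qed

text \<open>For the coordinate splitting both projections are diagonal, so the expression shared by
  \<open>p_loop\<close> and \<open>q_loop\<close> becomes a dilation.\<close>

lemma scaled_plus_const_coord:
  "scaled_loop f (proj_mat [coord_line k, coord_hyperplane k] 0)
    + const_loop (proj_mat [coord_line k, coord_hyperplane k] 1) = dilation k f"
  by (auto simp: vec_eq_iff scaled_loop_nth const_loop_nth proj_mat_def matrix_def decomposes_coord
      axis_def dilation_def replace_column_def)

lemma cnj_vec_coord:
  "cnj_vec ` coord_line k = coord_line k" "cnj_vec ` coord_hyperplane k = coord_hyperplane k"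
  by (auto simp: coord_line_def coord_hyperplane_def image_iff intro: exI[of _ "cnj_vec _"])
    (metis cnj_vec_cnj_vec cnj_vec_nth complex_cnj_zero)+

subsection \<open>Generating dilations and transvections\<close>

lemma degree_x_power: "degree ([:0, 1:] ^ m :: complex poly) = m"
  and coeff_x_power: "coeff ([:0, 1:] ^ m :: complex poly) m = 1"
  using lead_coeff_power[of "[:0, 1:] :: complex poly" m] by (simp_all add: degree_linear_power)

context
  fixes G :: "('n::finite loop) monoid" and H :: "('n loop) set"
  defines "G \<equiv> real_negative_loops" and "H \<equiv> generate G (p_loops \<union> q_loops \<union> r_loops \<union> m_loops)"
begin

lemma generated_mult: "g \<in> H \<Longrightarrow> h \<in> H \<Longrightarrow> g ** h \<in> H"
  unfolding H_def using generate.eng[of g G _ h] by (simp add: G_def real_negative_loops_def)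

lemma generated_one: "mat 1 \<in> H"
  unfolding H_def using generate.one[of G] by (simp add: G_def real_negative_loops_def)

lemma generators_subset_carrier: "p_loops \<union> q_loops \<union> r_loops \<union> m_loops \<subseteq> carrier G"
  unfolding G_def carrier_real_negative_loops
  using p_loops_near_identity q_loops_near_identity r_loops_near_identity m_loops_near_identity
  by blast

lemma generated_dilation_inverse:
  assumes "dilation k u \<in> H" "u - 1 \<in> strictly_proper_real"
  shows "dilation k (1 / u) \<in> H"
proof -
  interpret group G unfolding G_def by (rule group_real_negative_loops)
  have "u \<noteq> 0" using assms(2) by (rule one_plus_strictly_proper_nonzero)
  then have "dilation k (1 / u) \<otimes>\<^bsub>G\<^esub> dilation k u = \<one>\<^bsub>G\<^esub>"
    by (simp add: G_def real_negative_loops_def dilation_mult dilation_one)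
  moreover have "dilation k u \<in> carrier G" "dilation k (1 / u) \<in> carrier G"
    using assms(2)
    by (simp_all add: G_def carrier_real_negative_loops dilation_near_identity
        one_plus_strictly_proper_inverse)
  ultimately have "inv\<^bsub>G\<^esub> (dilation k u) = dilation k (1 / u)"
    by (rule inv_equality)
  then show ?thesis
    using generate_m_inv_closed[OF generators_subset_carrier, of "dilation k u"] assms(1)
    by (simp add: H_def)
qed

lemma generated_dilation_linear:
  assumes "a \<in> \<real>"
  shows "dilation k (to_fract [:- a, 1:] / to_fract [:0, 1:]) \<in> H"
\<comment> \<open>The pole is placed at 0, and \<open>p_loops\<close> demands a zero distinct from
  it. For \<open>a = 0\<close> the quotient is 1.\<close>
proof (cases "a = 0")
  case True
  then show ?thesis using generated_one by (simp add: dilation_one)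
next
  case False
  have "p_loop a 0 (coord_line k) (coord_hyperplane k) = dilation k (to_fract [:- a, 1:] / to_fract [:0, 1:])"
    unfolding p_loop_def linear_quotient scaled_plus_const_coord by simp
  moreover have "p_loop a 0 (coord_line k) (coord_hyperplane k) \<in> p_loops"
    unfolding p_loops_def using False assms Reals_0 direct_decomp_coord cnj_vec_coord by blast
  ultimately show ?thesis
    unfolding H_def by (metis UnI1 generate.incl)
qed

lemma generated_dilation_quadratic:
  assumes "a \<notin> \<real>"
  shows "dilation k (to_fract ([:- a, 1:] * map_poly cnj [:- a, 1:]) / to_fract ([:0, 1:] ^ 2)) \<in> H"
proof -
  have "q_loop a 0 (coord_line k) (coord_hyperplane k)
      = dilation k (to_fract ([:- a, 1:] * map_poly cnj [:- a, 1:]) / to_fract ([:0, 1:] ^ 2))"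
    unfolding q_loop_def quadratic_quotient scaled_plus_const_coord by (simp add: power2_eq_square)
  moreover have "a \<noteq> 0" using assms by auto
  then have "q_loop a 0 (coord_line k) (coord_hyperplane k) \<in> q_loops"
    unfolding q_loops_def using assms direct_decomp_coord cnj_vec_coord by blast
  ultimately show ?thesis
    unfolding H_def by (metis UnI1 UnI2 generate.incl)
qed

text \<open>Strong induction on the degree, splitting off a real linear factor or a conjugate pair
  of factors. Since degrees add, the power of the coordinate function in the denominator splits
  accordingly.\<close>

lemma generated_dilation_monic:
  assumes "real_poly p" "lead_coeff p = 1"
  shows "dilation k (to_fract p / to_fract ([:0, 1:] ^ degree p)) \<in> H"
  using assms
proof (induction "degree p" arbitrary: p rule: less_induct)
  case less
  \<comment> \<open>The step common to both kinds of factor: the cofactor \<open>r\<close> is again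
    real and monic, of smaller degree.\<close>
  have factor: ?case if q: "real_poly q" "p = q * r" "lead_coeff q = 1" "degree q > 0"
    "dilation k (to_fract q / to_fract ([:0, 1:] ^ degree q)) \<in> H" for q r
  proof -
    have nz: "q \<noteq> 0" "r \<noteq> 0" using q(2) less.prems by auto
    then have deg: "degree p = degree q + degree r" by (simp add: q(2) degree_mult_eq)
    have "real_poly r" using less.prems q nz by (auto intro: real_poly_cancel)
    moreover have "lead_coeff r = 1"
      using less.prems(2) q(3) by (simp only: q(2) lead_coeff_mult mult_1)
    ultimately have r: "dilation k (to_fract r / to_fract ([:0, 1:] ^ degree r)) \<in> H"
      using deg q(4) by (intro less.hyps) auto
    have "to_fract p = to_fract q * to_fract r" by (simp add: q(2))
    then show ?thesis
      using generated_mult[OF q(5) r]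
      unfolding dilation_mult times_divide_times_eq deg power_add to_fract_mult by simp
  qed
  show ?case
  proof (cases "degree p = 0")
    case True
    then have "p = 1" using less.prems(2) by (metis degree_eq_zeroE lead_coeff_pCons(2) one_pCons)
    then show ?thesis using generated_one by (simp add: dilation_one)
  next
    case False
    then obtain a where a: "poly p a = 0"
      using fundamental_theorem_of_algebra[of p] unfolding constant_degree by auto
    then obtain r where r: "p = [:- a, 1:] * r" by (auto simp: poly_eq_0_iff_dvd)
    show ?thesis
    proof (cases "a \<in> \<real>")
      case True
      then show ?thesis
        using generated_dilation_linear[OF True] by (intro factor[OF _ r]) simp_all
    next
      case False
      \<comment> \<open>A nonreal root comes with its conjugate, which differs from it and is
        therefore a root of the cofactor \<open>r\<close>.\<close>
      have "poly p (cnj a) = 0"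
        using a less.prems(1) by (metis complex_cnj_zero poly_cnj real_poly_def)
      moreover have "poly [:- a, 1:] (cnj a) \<noteq> 0"
        using False by (auto simp: Reals_cnj_iff)
      ultimately have "poly r (cnj a) = 0" by (simp add: r)
      then obtain s where "r = [:- cnj a, 1:] * s" by (auto simp: poly_eq_0_iff_dvd)
      then have p: "p = ([:- a, 1:] * map_poly cnj [:- a, 1:]) * s"
        by (simp only: r map_poly_cnj_linear mult.assoc) simp
      show ?thesis
      proof (rule factor[OF real_poly_conj_mult p])
        have deg: "degree ([:- a, 1:] * map_poly cnj [:- a, 1:]) = 2" by simp
        show "degree ([:- a, 1:] * map_poly cnj [:- a, 1:]) > 0" unfolding deg by simp
        show "lead_coeff ([:- a, 1:] * map_poly cnj [:- a, 1:]) = 1"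
          unfolding lead_coeff_mult by simp
        show "dilation k (to_fract ([:- a, 1:] * map_poly cnj [:- a, 1:])
            / to_fract ([:0, 1:] ^ degree ([:- a, 1:] * map_poly cnj [:- a, 1:]))) \<in> H"
          unfolding deg by (rule generated_dilation_quadratic[OF False])
      qed
    qed
  qed
qed

text \<open>Numerator and denominator are monic of equal degree. Each is divided by the same power
  of the coordinate function, and these powers cancel in the quotient.\<close>

lemma generated_dilation:
  assumes "u - 1 \<in> strictly_proper_real"
  shows "dilation k u \<in> H"
proof -
  obtain p q where pq: "u = to_fract p / to_fract q" "real_poly p" "real_poly q"
    "lead_coeff p = 1" "lead_coeff q = 1" "degree p = degree q"
    using assms by (rule one_plus_strictly_properE)
  let ?x = "[:0, 1:] ^ degree q :: complex poly"
  have "dilation k (to_fract p / to_fract ?x) \<in> H"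
    using generated_dilation_monic[of p] pq by simp
  moreover have "dilation k (1 / (to_fract q / to_fract ?x)) \<in> H"
  proof (rule generated_dilation_inverse)
    show "dilation k (to_fract q / to_fract ?x) \<in> H"
      using generated_dilation_monic[of q] pq by simp
    show "to_fract q / to_fract ?x - 1 \<in> strictly_proper_real"
      using pq by (intro one_plus_strictly_properI real_poly_power)
        (auto simp: degree_x_power coeff_x_power)
  qed
  ultimately have "dilation k (to_fract p / to_fract ?x * (1 / (to_fract q / to_fract ?x))) \<in> H"
    unfolding dilation_mult [symmetric] by (rule generated_mult)
  moreover have "?x \<noteq> 0" by simp
  then have "to_fract p / to_fract ?x * (1 / (to_fract q / to_fract ?x)) = u"
    unfolding pq(1) using to_fract_nonzero[of ?x] by simp
  ultimately show ?thesis by simp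
qed

lemma generated_transvection_monomial:
  assumes "i \<noteq> k" "c \<in> \<real>" "0 < m"
  shows "transvection i k (rf_const c / to_fract ([:0, 1:] ^ m)) \<in> H"
proof -
  \<comment> \<open>A real multiple of an off-diagonal matrix unit, which squares to zero because
    \<open>i \<noteq> k\<close>.\<close>
  define N :: "complex^'n^'n" where "N = (\<chi> a b. if a = i \<and> b = k then c else 0)"
  have "(\<Sum>l\<in>UNIV. N $ a $ l * N $ l $ b) = 0" for a b
    by (rule sum.neutral) (use assms(1) in \<open>auto simp: N_def\<close>)
  then have "N ** N = 0"
    by (simp add: vec_eq_iff matrix_matrix_mult_def)
  moreover have "map_matrix cnj N = N"
    using assms(2) by (simp add: vec_eq_iff N_def map_matrix_def Reals_cnj_iff)
  ultimately have "m_loop 0 m N \<in> m_loops"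
    using assms(3) Reals_0 unfolding m_loops_def by blast
  moreover have "m_loop 0 m N = transvection i k (rf_const c / to_fract ([:0, 1:] ^ m))"
    using assms(1) unfolding m_loop_def inverse_linear_power
    by (auto simp: vec_eq_iff scaled_loop_nth N_def transvection_def replace_column_def mat_def)
  ultimately show ?thesis
    unfolding H_def by (metis UnI2 generate.incl)
qed

lemma generated_transvection:
  assumes "i \<noteq> k" "c \<in> strictly_proper_real"
  shows "transvection i k c \<in> H"
proof (cases "c = 0")
  case True
  then show ?thesis using generated_one by (simp add: transvection_zero)
next
  case False
  obtain p q where pq: "c = to_fract p / to_fract q" "real_poly p" "real_poly q"
    "degree p < degree q" "q \<noteq> 0" using assms(2) by (rule strictly_proper_realE)
  have "p \<noteq> 0" using False pq(1) by auto
  \<comment> \<open>\<open>m\<close> is the order of vanishing of \<open>c\<close> at infinity,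
    positive since \<open>c\<close> is strictly proper, and \<open>l\<close> is the limit of
    \<lambda>^m c. Hence \<open>u\<close>, which is \<lambda>^m c / l, has value 1 at
    infinity.\<close>
  define m where "m = degree q - degree p"
  define x :: "complex poly" where "x = [:0, 1:] ^ m"
  define l where "l = lead_coeff p / lead_coeff q"
  define u where "u = to_fract (p * x) / to_fract ([:l:] * q)"
  have x: "real_poly x" "lead_coeff x = 1" "degree x = m" "x \<noteq> 0"
    by (auto simp: x_def degree_x_power coeff_x_power intro: real_poly_power)
  have l: "l \<in> \<real>" "l \<noteq> 0"
    using real_poly_lead_coeff[OF pq(2)] real_poly_lead_coeff[OF pq(3)] \<open>p \<noteq> 0\<close> \<open>q \<noteq> 0\<close>
    by (auto simp: l_def)
  have "lead_coeff (p * x) = lead_coeff ([:l:] * q)"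
    unfolding lead_coeff_mult x(2) using \<open>q \<noteq> 0\<close> by (simp add: l_def)
  moreover have "degree (p * x) = degree ([:l:] * q)"
    using x \<open>p \<noteq> 0\<close> \<open>q \<noteq> 0\<close> l pq(4) by (simp add: degree_mult_eq m_def)
  ultimately have u: "u - 1 \<in> strictly_proper_real"
    unfolding u_def using pq x l by (intro one_plus_strictly_properI real_poly_mult) auto
  then have "u \<noteq> 0" by (rule one_plus_strictly_proper_nonzero)
  have "dilation i u ** (transvection i k (rf_const l / to_fract x) ** dilation i (1 / u)) \<in> H"
    unfolding x_def
    using u assms(1) l(1) pq(4)
    by (intro generated_mult generated_dilation generated_transvection_monomial
        one_plus_strictly_proper_inverse) (auto simp: m_def)
  then have "transvection i k (u * (rf_const l / to_fract x)) \<in> H"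
    unfolding dilation_transvection_dilation[OF assms(1) \<open>u \<noteq> 0\<close>] .
  moreover have "u * (rf_const l / to_fract x) = c"
    using x(4) l(2) to_fract_nonzero[of "[:l:]"] unfolding u_def pq(1) rf_const_def to_fract_mult
    by simp
  ultimately show ?thesis by simp
qed

lemma generated_eq_carrier: "H = carrier G"
proof
  interpret group G unfolding G_def by (rule group_real_negative_loops)
  show "H \<subseteq> carrier G"
    unfolding H_def using generators_subset_carrier by (rule generate_incl)
  show "carrier G \<subseteq> H"
  proof
    fix g assume "g \<in> carrier G"
    then have "g \<in> near_identity" by (simp add: G_def carrier_real_negative_loops)
    then show "g \<in> H"
      by (induction rule: near_identity_induct)
        (auto intro: generated_one generated_mult generated_dilation generated_transvection)
  qed
qed

end

theorem theorem4p1: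
  shows "group (real_negative_loops :: ('n::finite loop) monoid) \<and>
    generate (real_negative_loops :: ('n loop) monoid) (p_loops \<union> q_loops \<union> r_loops \<union> m_loops)
      = carrier real_negative_loops"
  using group_real_negative_loops generated_eq_carrier by blast

end
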